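(* No online algorithm can be better than $\min\big\{\log^{1-o(1)}(N\lambda^* ),\ \frac{N-1}{e}\big\}$-competitive, where $N$ is the number of agents and $\lambda^*$ is the balance ratio of the instance; that is, for every online algorithm, the worst-case ratio of the optimal Nash welfare to the algorithm's (expected) Nash welfare over instances with $N$ agents and balance ratio at most $\lambda^*$ is at least $\min\{\log^{1-o(1)}(N\lambda^* ), \frac{N-1}{e}\}$.
   Context: There are $N$ agents and divisible items arriving online; item $t$ has supply $s_t>0$ and agent $i$ has value $v_{it}\ge0$ per unit of item $t$. An allocation $(x_{it})$ is non-negative with $\sum_i x_{it}\le s_t$; utilities are $u_i=\sum_t x_{it}v_{it}$ and the Nash welfare is $(\prod_i u_i)^{1/N}$. An online algorithm allocates each item irrevocably upon arrival, seeing only the supply of and the values for items arrived so far. The monopolist utility of agent $i$ is $V_i=\sum_t s_tv_{it}$ and the balance ratio is $\lambda^*=\max_iV_i/\min_iV_i$. Logarithms are natural; $o(1)$ denotes a term tending to $0$ as its argument grows. *)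

theory Defs
  imports "HOL-Probability.Probability"
begin

text \<open>
  The agents are \<open>0, \<dots>, N - 1\<close>; an instance is the list of its items in order of arrival.
\<close>

datatype item = Item (item_supply: real) (item_value: "nat \<Rightarrow> real")

text \<open>
  Values at indices \<open>i \<ge> N\<close> have no meaning. They are fixed to be \<open>0\<close> so that an item shows an
  algorithm nothing but its supply and the values of the \<open>N\<close> agents.
\<close>

definition valid_items :: "nat \<Rightarrow> item list \<Rightarrow> bool" where
  "valid_items N I \<longleftrightarrow> (\<forall>a\<in>set I. item_supply a > 0 \<and> (\<forall>i<N. item_value a i \<ge> 0) \<and>
     (\<forall>i\<ge>N. item_value a i = 0))"

definition allocation :: "nat \<Rightarrow> item list \<Rightarrow> (nat \<Rightarrow> nat \<Rightarrow> real) \<Rightarrow> bool" where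
  "allocation N I x \<longleftrightarrow> (\<forall>t<length I. (\<forall>i<N. x i t \<ge> 0) \<and> (\<Sum>i<N. x i t) \<le> item_supply (I ! t))"

definition utility :: "item list \<Rightarrow> (nat \<Rightarrow> nat \<Rightarrow> real) \<Rightarrow> nat \<Rightarrow> real" where
  "utility I x i = (\<Sum>t<length I. x i t * item_value (I ! t) i)"

definition nash_welfare :: "nat \<Rightarrow> item list \<Rightarrow> (nat \<Rightarrow> nat \<Rightarrow> real) \<Rightarrow> real" where
  "nash_welfare N I x = root N (\<Prod>i<N. utility I x i)"

definition optimal_nash_welfare :: "nat \<Rightarrow> item list \<Rightarrow> ennreal" where
  "optimal_nash_welfare N I = (SUP x\<in>{x. allocation N I x}. ennreal (nash_welfare N I x))"

definition monopolist_utility :: "item list \<Rightarrow> nat \<Rightarrow> real" where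
  "monopolist_utility I i = (\<Sum>t<length I. item_supply (I ! t) * item_value (I ! t) i)"

definition balance_ratio :: "nat \<Rightarrow> item list \<Rightarrow> real" where
  "balance_ratio N I =
     Max (monopolist_utility I ` {..<N}) / Min (monopolist_utility I ` {..<N})"

text \<open>
  Positivity of the monopolist utilities is what makes the balance ratio well defined; without it,
  division by zero would give such instances the ratio \<open>0\<close>.
\<close>

definition instances :: "nat \<Rightarrow> real \<Rightarrow> item list set" where
  "instances N lam = {I. valid_items N I \<and> (\<forall>i<N. monopolist_utility I i > 0) \<and>
     balance_ratio N I \<le> lam}"

text \<open>
  A deterministic online algorithm maps the nonempty list of the items arrived so far to the
  allocation of the last of them. Its own earlier decisions are determined by that list.
\<close>

type_synonym strategy = "item list \<Rightarrow> nat \<Rightarrow> real"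

definition run :: "strategy \<Rightarrow> item list \<Rightarrow> nat \<Rightarrow> nat \<Rightarrow> real" where
  "run A I i t = A (take (Suc t) I) i"

definition deterministic_online_algorithm :: "nat \<Rightarrow> strategy \<Rightarrow> bool" where
  "deterministic_online_algorithm N A \<longleftrightarrow> (\<forall>I. valid_items N I \<longrightarrow> allocation N I (run A I))"

text \<open>
  A (possibly randomized) online algorithm is a probability distribution over deterministic ones,
  with respect to any sigma-algebra that makes each allocated amount a random variable.
  Deterministic algorithms are the point masses.
\<close>

definition online_algorithm :: "nat \<Rightarrow> strategy measure \<Rightarrow> bool" where
  "online_algorithm N M \<longleftrightarrow> prob_space M \<and>
     (\<forall>A\<in>space M. deterministic_online_algorithm N A) \<and>
     (\<forall>I. valid_items N I \<longrightarrow>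
       (\<forall>i<N. \<forall>t<length I. (\<lambda>A. run A I i t) \<in> borel_measurable M))"

definition expected_nash_welfare :: "nat \<Rightarrow> item list \<Rightarrow> strategy measure \<Rightarrow> ennreal" where
  "expected_nash_welfare N I M = (\<integral>\<^sup>+ A. ennreal (nash_welfare N I (run A I)) \<partial>M)"

text \<open>
  On \<open>instances N lam\<close> the optimum is positive, so by the conventions of \<open>ennreal\<close> the ratio is infinite
  when the algorithm has expected Nash welfare \<open>0\<close>.
\<close>

definition worst_case_ratio :: "nat \<Rightarrow> real \<Rightarrow> strategy measure \<Rightarrow> ennreal" where
  "worst_case_ratio N lam M =
     (SUP I\<in>instances N lam. optimal_nash_welfare N I / expected_nash_welfare N I M)"

end

theory Submission
  imports Defs "HOL-Real_Asymp.Real_Asymp"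
begin

text \<open>
  The agents are split into \<open>m\<close> groups of \<open>K\<close> agents, one of each of \<open>K\<close> types. At every stage
  \<open>s < K\<close> each group receives one item, which is worth \<open>K ^ s\<close> to all its agents that are still
  present; then a type drops out, in an order \<open>\<sigma>\<close> that is uniformly random. The optimum gives every
  agent the last item that it values. An online algorithm cannot tell the \<open>K - s\<close> present types
  apart, so the type that is about to drop out receives an expected share of at most
  \<open>1 / (K - s)\<close>, and by the arithmetic-geometric mean inequality the ratio is about
  \<open>(fact K) powr (1 / K) \<ge> K / e\<close>.

  With \<open>K = N\<close> the balance ratio is at most \<open>N ^ N\<close>, which gives the bound \<open>(N - 1) / e\<close>. For a
  smaller \<open>lam\<close> a final item makes the monopolist utilities differ by a factor of at most \<open>lam\<close>; it
  does no harm as long as \<open>K ^ K \<lesssim> lam * N / K\<close>, that is, for \<open>K = log\<^bsup>1 - o(1)\<^esup> (N * lam)\<close>.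
\<close>

section \<open>Elementary sums, products and mean inequalities\<close>

lemma sum_nat_less_mult:
  "sum h {..<m * k :: nat} = (\<Sum>g<m. \<Sum>j<k. h (g * k + j))"
  by (simp add: sum_mult_product add.commute)

lemma prod_mod_less_mult:
  fixes f :: "nat \<Rightarrow> 'a :: comm_monoid_mult"
  shows "(\<Prod>i<m * k. f (i mod k)) = (\<Prod>j<k. f j) ^ m"
proof -
  have "(\<Prod>i\<in>{g * k..<g * k + k}. f (i mod k)) = (\<Prod>j<k. f j)" for g
  proof -
    have "(\<Prod>i\<in>{0 + g * k..<k + g * k}. f (i mod k)) = (\<Prod>j\<in>{0..<k}. f ((j + g * k) mod k))"
      by (rule prod.shift_bounds_nat_ivl)
    then show ?thesis
      by (simp add: add.commute atLeast0LessThan)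
  qed
  then show ?thesis
    unfolding prod.nat_group[symmetric] by simp
qed

lemma root_prod_le_mean:
  fixes x :: "nat \<Rightarrow> real"
  assumes "N > 0" and "\<And>i. i < N \<Longrightarrow> x i \<ge> 0"
  shows "root N (\<Prod>i<N. x i) \<le> (\<Sum>i<N. x i) / N"
proof -
  have "root N (\<Prod>i<N. x i) = (\<Prod>i<N. x i) powr (1 / N)"
    using assms prod_nonneg[of "{..<N}" x]
    by (cases "(\<Prod>i<N. x i) = 0") (simp_all add: root_powr_inverse del: prod_zero_iff)
  also have "\<dots> \<le> (\<Sum>i<N. x i / N)"
    using arith_geom_mean[of "{..<N}" x] assms by auto
  finally show ?thesis
    by (simp add: sum_divide_distrib)
qed

text \<open>The arithmetic-geometric mean inequality for the ratios \<open>u i / c i\<close>. It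
  loses little when \<open>c\<close> is nearly proportional to \<open>u\<close>.\<close>

lemma root_prod_le_weighted_mean:
  fixes u c :: "nat \<Rightarrow> real"
  assumes N: "N > 0" and u: "\<And>i. i < N \<Longrightarrow> u i \<ge> 0" and c: "\<And>i. i < N \<Longrightarrow> c i > 0"
  shows "root N (\<Prod>i<N. u i) \<le> root N (\<Prod>i<N. c i) * ((\<Sum>i<N. u i / c i) / N)"
proof -
  have "(\<Prod>i<N. u i) = (\<Prod>i<N. c i) * (\<Prod>i<N. u i / c i)"
    using c by (simp add: prod.distrib[symmetric] less_imp_neq[symmetric])
  then have "root N (\<Prod>i<N. u i) = root N (\<Prod>i<N. c i) * root N (\<Prod>i<N. u i / c i)"
    by (simp add: real_root_mult)
  also have "\<dots> \<le> root N (\<Prod>i<N. c i) * ((\<Sum>i<N. u i / c i) / N)"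
    using assms
    by (intro mult_left_mono root_prod_le_mean divide_nonneg_nonneg real_root_ge_zero prod_nonneg)
       (auto simp: less_imp_le)
  finally show ?thesis .
qed

text \<open>\<open>n ^ n / fact n\<close> is a single term of the exponential series at
  \<open>n\<close>, all of whose terms are non-negative.\<close>

lemma fact_ge_power_div_exp: "(real n / exp 1) ^ n \<le> fact n"
proof -
  have "real n ^ n / fact n \<le> exp (real n)"
  proof -
    have s: "(\<lambda>k. real n ^ k /\<^sub>R fact k) sums exp (real n)"
      by (rule exp_converges)
    have "real n ^ n /\<^sub>R fact n \<le> (\<Sum>k<Suc n. real n ^ k /\<^sub>R fact k)"
      by (intro member_le_sum) auto
    also have "\<dots> \<le> exp (real n)"
      unfolding sums_unique[OF s] using s by (intro sum_le_suminf) (auto simp: sums_iff)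
    finally show ?thesis by (simp add: divide_inverse mult.commute)
  qed
  then show ?thesis
    by (simp add: power_divide exp_of_nat_mult[of n 1, simplified, symmetric] field_simps)
qed

section \<open>Nash welfare and the reduction to an average over instances\<close>

lemma run_borel_measurable_nash_welfare:
  assumes "online_algorithm N M" "valid_items N I"
  shows "(\<lambda>A. nash_welfare N I (run A I)) \<in> borel_measurable M"
proof -
  have "(\<lambda>A. \<Prod>i<N. \<Sum>t<length I. run A I i t * item_value (I ! t) i) \<in> borel_measurable M"
    using assms unfolding online_algorithm_def
    by (intro borel_measurable_prod borel_measurable_sum borel_measurable_times) auto
  then show ?thesis
    unfolding nash_welfare_def utility_def by measurable
qed

lemma utility_nonneg:
  assumes "valid_items N I" "allocation N I x" "i < N"
  shows "utility I x i \<ge> 0"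
  using assms unfolding utility_def valid_items_def allocation_def
  by (intro sum_nonneg mult_nonneg_nonneg) auto

lemma nash_welfare_nonneg:
  assumes "valid_items N I" "allocation N I x" "N > 0"
  shows "nash_welfare N I x \<ge> 0"
  unfolding nash_welfare_def
  using assms by (intro real_root_ge_zero prod_nonneg) (auto intro: utility_nonneg)

text \<open>Yao's principle, with the uniform distribution on \<open>S\<close>.\<close>

lemma worst_case_ratio_ge_average:
  fixes I :: "'a \<Rightarrow> item list" and Q :: "'a \<Rightarrow> real"
  assumes M: "online_algorithm N M" and N: "N > 0"
    and S: "finite S" "S \<noteq> {}" and \<rho>: "\<rho> > 0"
    and I: "\<And>\<sigma>. \<sigma> \<in> S \<Longrightarrow> I \<sigma> \<in> instances N lam"
    and Q: "\<And>\<sigma>. \<sigma> \<in> S \<Longrightarrow> Q \<sigma> > 0"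
    and opt: "\<And>\<sigma>. \<sigma> \<in> S \<Longrightarrow> \<exists>x. allocation N (I \<sigma>) x \<and> nash_welfare N (I \<sigma>) x \<ge> Q \<sigma>"
    and det: "\<And>A. deterministic_online_algorithm N A \<Longrightarrow>
       (\<Sum>\<sigma>\<in>S. nash_welfare N (I \<sigma>) (run A (I \<sigma>)) / Q \<sigma>) \<le> card S / \<rho>"
  shows "ennreal \<rho> \<le> worst_case_ratio N lam M"
proof -
  interpret prob_space M
    using M by (simp add: online_algorithm_def)
  define E where "E \<sigma> = expected_nash_welfare N (I \<sigma>) M" for \<sigma>
  have valid: "valid_items N (I \<sigma>)" if "\<sigma> \<in> S" for \<sigma>
    using I[OF that] by (simp add: instances_def)
  have detM: "deterministic_online_algorithm N A" if "A \<in> space M" for A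
    using M that by (simp add: online_algorithm_def)
  have nn: "nash_welfare N (I \<sigma>) (run A (I \<sigma>)) \<ge> 0" if "\<sigma> \<in> S" "A \<in> space M" for \<sigma> A
    using detM[OF that(2)] valid[OF that(1)] N
    by (auto simp: deterministic_online_algorithm_def intro!: nash_welfare_nonneg)
  have meas: "(\<lambda>A. nash_welfare N (I \<sigma>) (run A (I \<sigma>))) \<in> borel_measurable M" if "\<sigma> \<in> S" for \<sigma>
    using run_borel_measurable_nash_welfare M valid[OF that] by blast
  have "(\<Sum>\<sigma>\<in>S. E \<sigma> / ennreal (Q \<sigma>)) =
      (\<Sum>\<sigma>\<in>S. \<integral>\<^sup>+ A. ennreal (nash_welfare N (I \<sigma>) (run A (I \<sigma>)) / Q \<sigma>) \<partial>M)"
  proof (rule sum.cong)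
    fix \<sigma> assume \<sigma>: "\<sigma> \<in> S"
    have "(\<integral>\<^sup>+ A. ennreal (nash_welfare N (I \<sigma>) (run A (I \<sigma>)) / Q \<sigma>) \<partial>M) =
        (\<integral>\<^sup>+ A. ennreal (nash_welfare N (I \<sigma>) (run A (I \<sigma>))) / ennreal (Q \<sigma>) \<partial>M)"
      using nn[OF \<sigma>] Q[OF \<sigma>] by (intro nn_integral_cong) (simp add: divide_ennreal)
    also have "\<dots> = E \<sigma> / ennreal (Q \<sigma>)"
      using meas[OF \<sigma>] by (simp add: E_def expected_nash_welfare_def nn_integral_divide)
    finally show "E \<sigma> / ennreal (Q \<sigma>) =
      (\<integral>\<^sup>+ A. ennreal (nash_welfare N (I \<sigma>) (run A (I \<sigma>)) / Q \<sigma>) \<partial>M)" by simp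
  qed simp
  also have "\<dots> = (\<integral>\<^sup>+ A. (\<Sum>\<sigma>\<in>S. ennreal (nash_welfare N (I \<sigma>) (run A (I \<sigma>)) / Q \<sigma>)) \<partial>M)"
    using meas by (intro nn_integral_sum[symmetric]) auto
  also have "\<dots> \<le> (\<integral>\<^sup>+ A. ennreal (card S / \<rho>) \<partial>M)"
    using nn Q det[OF detM] by (intro nn_integral_mono) (auto intro!: ennreal_leI simp: less_imp_le)
  also have "\<dots> = ennreal (card S / \<rho>)"
    by (simp add: emeasure_space_1)
  finally have sum_le: "(\<Sum>\<sigma>\<in>S. E \<sigma> / ennreal (Q \<sigma>)) \<le> ennreal (card S / \<rho>)" .
  \<comment> \<open>Not all summands can exceed the average.\<close>
  have "\<exists>\<sigma>\<in>S. E \<sigma> / ennreal (Q \<sigma>) \<le> ennreal (1 / \<rho>)"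
  proof (rule ccontr)
    assume "\<not> ?thesis"
    then have gt: "ennreal (1 / \<rho>) < E \<sigma> / ennreal (Q \<sigma>)" if "\<sigma> \<in> S" for \<sigma>
      using that by (auto simp: not_le)
    define e where "e \<sigma> = enn2real (E \<sigma> / ennreal (Q \<sigma>))" for \<sigma>
    have "E \<sigma> / ennreal (Q \<sigma>) < top" if "\<sigma> \<in> S" for \<sigma>
      using sum_le S that
      by (meson ennreal_less_top le_less_trans member_le_sum zero_le)
    then have e: "E \<sigma> / ennreal (Q \<sigma>) = ennreal (e \<sigma>)" if "\<sigma> \<in> S" for \<sigma>
      using that by (simp add: e_def)
    have e0: "e \<sigma> \<ge> 0" for \<sigma> by (simp add: e_def)
    have "1 / \<rho> < e \<sigma>" if "\<sigma> \<in> S" for \<sigma>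
      using gt[OF that] e[OF that] \<rho> by (simp add: ennreal_less_iff)
    then have "(\<Sum>\<sigma>\<in>S. 1 / \<rho>) < (\<Sum>\<sigma>\<in>S. e \<sigma>)"
      using S by (intro sum_strict_mono) auto
    moreover have "(\<Sum>\<sigma>\<in>S. e \<sigma>) \<le> card S / \<rho>"
      using sum_le e e0 \<rho> by (simp add: sum_ennreal)
    ultimately show False by simp
  qed
  then obtain \<sigma> where \<sigma>: "\<sigma> \<in> S" "E \<sigma> / ennreal (Q \<sigma>) \<le> ennreal (1 / \<rho>)" by blast
  have "ennreal (Q \<sigma>) \<le> optimal_nash_welfare N (I \<sigma>)"
  proof -
    obtain x where "allocation N (I \<sigma>) x" "nash_welfare N (I \<sigma>) x \<ge> Q \<sigma>"
      using opt \<sigma> by blast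
    then show ?thesis
      unfolding optimal_nash_welfare_def by (intro SUP_upper2[of x] ennreal_leI) auto
  qed
  moreover have "ennreal \<rho> \<le> ennreal (Q \<sigma>) / E \<sigma>"
  proof -
    have "E \<sigma> \<noteq> top"
      using \<sigma>(2) by (auto simp: ennreal_top_divide top_unique)
    then obtain e where e: "E \<sigma> = ennreal e" "e \<ge> 0"
      by (cases "E \<sigma>") auto
    show ?thesis
    \<comment> \<open>Expected welfare \<open>0\<close> makes the quotient infinite in
      \<open>ennreal\<close>, because \<open>Q \<sigma>\<close> is positive.\<close>
    proof (cases "e = 0")
      case True
      then show ?thesis using e Q[OF \<sigma>(1)] by simp
    next
      case False
      then show ?thesis
        using e \<sigma> Q[OF \<sigma>(1)] \<rho> by (auto simp: divide_ennreal field_simps intro!: ennreal_leI)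
    qed
  qed
  ultimately have "ennreal \<rho> \<le> optimal_nash_welfare N (I \<sigma>) / E \<sigma>"
    by (meson divide_right_mono_ennreal order_trans)
  also have "\<dots> \<le> worst_case_ratio N lam M"
    unfolding worst_case_ratio_def E_def using I[OF \<sigma>(1)] by (rule SUP_upper)
  finally show ?thesis .
qed

text \<open>With a single item worth \<open>1\<close> to everyone, nothing beats the equal division.
  This serves the range where \<open>N * lam\<close> is too small for the asymptotic
  estimates.\<close>

lemma worst_case_ratio_ge_1:
  assumes M: "online_algorithm N M" and N: "N > 0" and lam: "lam \<ge> 1"
  shows "1 \<le> worst_case_ratio N lam M"
proof -
  define J where "J = [Item 1 (\<lambda>i. if i < N then 1 else 0)]"
  have V: "monopolist_utility J i = (if i < N then 1 else 0)" for i
    by (simp add: monopolist_utility_def J_def)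
  have img: "monopolist_utility J ` {..<N} = {1}"
    using N by (force simp: V)
  have "balance_ratio N J = 1"
    unfolding balance_ratio_def img by simp
  then have J: "J \<in> instances N lam"
    using lam by (simp add: instances_def V) (simp add: valid_items_def J_def)
  have util: "utility J x i = x i 0" if "i < N" for i x
    using that by (simp add: utility_def J_def)
  have "ennreal 1 \<le> worst_case_ratio N lam M"
  proof (rule worst_case_ratio_ge_average[where S = "{()}" and I = "\<lambda>_. J" and Q = "\<lambda>_. 1 / N"])
    show "\<exists>x. allocation N J x \<and> 1 / real N \<le> nash_welfare N J x"
    proof (intro exI conjI)
      show "allocation N J (\<lambda>_ _. 1 / N)"
        using N by (simp add: allocation_def J_def)
      show "1 / real N \<le> nash_welfare N J (\<lambda>_ _. 1 / N)"
        using N by (simp add: nash_welfare_def util real_root_power_cancel)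
    qed
    fix A assume "deterministic_online_algorithm N A"
    then have a: "allocation N J (run A J)"
      using J by (auto simp: deterministic_online_algorithm_def instances_def)
    have "nash_welfare N J (run A J) = root N (\<Prod>i<N. run A J i 0)"
      by (simp add: nash_welfare_def util)
    also have "\<dots> \<le> (\<Sum>i<N. run A J i 0) / N"
      using a by (intro root_prod_le_mean[OF N]) (auto simp: allocation_def J_def)
    also have "\<dots> \<le> 1 / N"
      using a by (intro divide_right_mono) (auto simp: allocation_def J_def)
    finally show "(\<Sum>\<sigma>\<in>{()}. nash_welfare N J (run A J) / (1 / real N)) \<le> card {()} / 1"
      using N by (simp add: field_simps)
  qed (use M N J in auto)
  then show ?thesis by simp
qed

section \<open>The hard instances\<close>

locale hard_instance =
  fixes N K m :: nat and lam :: real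
  assumes K: "K \<ge> 2" and m: "m \<ge> 1" and mK_le: "m * K \<le> N" and lam: "lam \<ge> 1"
begin

text \<open>The total value of the stage items to an agent whose type has last stage
  \<open>p\<close>; \<open>V\<close> belongs to the type that stays to the end.\<close>

definition W :: "nat \<Rightarrow> real" where "W p = (\<Sum>s\<le>p. real K ^ s)"

definition V :: real where "V = W (K - 1)"

text \<open>
  Agent \<open>i < m * K\<close> has type \<open>i mod K\<close> and belongs to group \<open>i div K\<close>; \<open>\<sigma>\<close> maps a type to the last
  stage whose items it values. Item \<open>t < K * m\<close> belongs to stage \<open>t div m\<close> and group \<open>t mod m\<close>.
\<close>

definition stage_item :: "(nat \<Rightarrow> nat) \<Rightarrow> nat \<Rightarrow> item" where
  "stage_item \<sigma> t = Item 1 (\<lambda>i.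
     if i < m * K \<and> i div K = t mod m \<and> t div m \<le> \<sigma> (i mod K) then real K ^ (t div m) else 0)"

text \<open>
  The supply \<open>1\<close> of the balancing item is shared by all agents. It raises every monopolist utility
  to at least \<open>V / lam\<close>, but the average utility that it adds is only about \<open>V / (lam * N)\<close>. The
  agents \<open>i \<ge> m * K\<close>, left over when \<open>K\<close> does not divide \<open>N\<close>, value nothing else.
\<close>

definition bal :: "nat \<Rightarrow> real" where "bal p = max 0 (V / lam - W p)"

definition balancing_item :: "(nat \<Rightarrow> nat) \<Rightarrow> item" where
  "balancing_item \<sigma> = Item 1 (\<lambda>i.
     if i < m * K then bal (\<sigma> (i mod K)) else if i < N then V else 0)"

definition inst :: "(nat \<Rightarrow> nat) \<Rightarrow> item list" where
  "inst \<sigma> = map (stage_item \<sigma>) [0..<K * m] @ [balancing_item \<sigma>]"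

lemma length_inst [simp]: "length (inst \<sigma>) = Suc (K * m)"
  by (simp add: inst_def)

lemma nth_inst: "t < K * m \<Longrightarrow> inst \<sigma> ! t = stage_item \<sigma> t"
  by (simp add: inst_def nth_append)

lemma nth_inst_last: "inst \<sigma> ! (K * m) = balancing_item \<sigma>"
  by (simp add: inst_def nth_append)

lemma supply_inst: "t \<le> K * m \<Longrightarrow> item_supply (inst \<sigma> ! t) = 1"
  by (cases "t = K * m") (auto simp: nth_inst nth_inst_last stage_item_def balancing_item_def)

lemma W_ge_1: "W p \<ge> 1"
proof -
  have "real K ^ 0 \<le> W p"
    unfolding W_def by (rule member_le_sum) auto
  then show ?thesis by simp
qed

lemma W_le_V: "p < K \<Longrightarrow> W p \<le> V"
  unfolding V_def W_def by (intro sum_mono2) auto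

lemma V_ge_1: "V \<ge> 1"
  by (simp add: V_def W_ge_1)

lemma bal_nonneg: "bal p \<ge> 0"
  by (simp add: bal_def)

lemma bal_le: "bal p \<le> max 0 (V / lam - 1)"
  using W_ge_1[of p] by (simp add: bal_def)

lemma valid_inst: "valid_items N (inst \<sigma>)"
  using mK_le V_ge_1
  by (auto simp: valid_items_def inst_def stage_item_def balancing_item_def bal_nonneg)

lemma pair_less: "a < (n::nat) \<Longrightarrow> b < k \<Longrightarrow> a * k + b < n * k"
proof -
  assume "a < n" "b < k"
  then have "a * k + b < Suc a * k" by simp
  also have "\<dots> \<le> n * k" using \<open>a < n\<close> by (intro mult_le_mono1) simp
  finally show ?thesis .
qed

text \<open>Writing \<open>t = s * m + h\<close> with \<open>h < m\<close> splits a position into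
  stage and group; only stage items with \<open>h = g\<close> and \<open>s \<le> \<sigma> j\<close>
  are worth anything to the agent.\<close>

lemma utility_type:
  assumes \<sigma>: "\<sigma> permutes {..<K}" and g: "g < m" and j: "j < K"
  shows "utility (inst \<sigma>) x (g * K + j) =
    (\<Sum>s\<le>\<sigma> j. x (g * K + j) (s * m + g) * real K ^ s) + x (g * K + j) (K * m) * bal (\<sigma> j)"
proof -
  let ?i = "g * K + j"
  have i: "?i < m * K" by (rule pair_less[OF g j])
  have \<sigma>j: "\<sigma> j < K" using permutes_in_image[OF \<sigma>, of j] j by simp
  have "(\<Sum>t<K * m. x ?i t * item_value (inst \<sigma> ! t) ?i) =
      (\<Sum>s<K. \<Sum>h<m. x ?i (s * m + h) * item_value (inst \<sigma> ! (s * m + h)) ?i)"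
    by (rule sum_nat_less_mult)
  also have "\<dots> = (\<Sum>s<K. \<Sum>h<m. if h = g then
      (if s \<le> \<sigma> j then x ?i (s * m + g) * real K ^ s else 0) else 0)"
  proof (intro sum.cong refl)
    fix s h assume "s \<in> {..<K}" "h \<in> {..<m}"
    then show "x ?i (s * m + h) * item_value (inst \<sigma> ! (s * m + h)) ?i =
      (if h = g then (if s \<le> \<sigma> j then x ?i (s * m + g) * real K ^ s else 0) else 0)"
      using i j by (simp add: nth_inst pair_less stage_item_def)
  qed
  also have "\<dots> = (\<Sum>s<K. if s \<le> \<sigma> j then x ?i (s * m + g) * real K ^ s else 0)"
    using g by simp
  also have "\<dots> = (\<Sum>s\<le>\<sigma> j. x ?i (s * m + g) * real K ^ s)"
    using \<sigma>j by (intro sum.mono_neutral_cong_right) auto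
  finally show ?thesis
    using i j by (simp add: utility_def nth_inst_last balancing_item_def)
qed

lemma utility_rest:
  assumes "m * K \<le> i" "i < N"
  shows "utility (inst \<sigma>) x i = x i (K * m) * V"
  using assms
  by (simp add: utility_def nth_inst nth_inst_last stage_item_def balancing_item_def)

lemma agent_cases:
  assumes "i < N"
  obtains g j where "g < m" "j < K" "i = g * K + j" | "m * K \<le> i"
proof (cases "i < m * K")
  case True
  then have "i div K < m" "i mod K < K" "i = i div K * K + i mod K"
    using K by (auto simp: less_mult_imp_div_less)
  then show ?thesis using that by blast
qed (use that in auto)

text \<open>All supplies are \<open>1\<close>, so the monopolist utility is the utility under the
  constant \<open>1\<close>. There \<open>bal\<close> fills \<open>W p\<close> up to
  \<open>V / lam\<close>, which does not exceed \<open>V\<close>.\<close>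

lemma monopolist_inst:
  assumes \<sigma>: "\<sigma> permutes {..<K}" and i: "i < N"
  shows "V / lam \<le> monopolist_utility (inst \<sigma>) i" "monopolist_utility (inst \<sigma>) i \<le> V"
proof -
  have eq: "monopolist_utility (inst \<sigma>) i = utility (inst \<sigma>) (\<lambda>_ _. 1) i"
    unfolding monopolist_utility_def utility_def by (intro sum.cong) (auto simp: supply_inst)
  have *: "V / lam \<le> V" using V_ge_1 lam by (simp add: field_simps)
  have "V / lam \<le> monopolist_utility (inst \<sigma>) i \<and> monopolist_utility (inst \<sigma>) i \<le> V"
    using i
  proof (cases i rule: agent_cases)
    case (1 g j)
    then have "\<sigma> j < K" using permutes_in_image[OF \<sigma>, of j] by simp
    then show ?thesis
      unfolding eq using 1 * W_le_V[of "\<sigma> j"]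
      by (simp add: utility_type[OF \<sigma>] W_def[symmetric] bal_def max_def)
  next
    case 2
    then show ?thesis using * i by (simp add: eq utility_rest)
  qed
  then show "V / lam \<le> monopolist_utility (inst \<sigma>) i" "monopolist_utility (inst \<sigma>) i \<le> V" by auto
qed

lemma N_pos: "N > 0"
  using K m mK_le by (cases N) auto

lemma inst_instances:
  assumes \<sigma>: "\<sigma> permutes {..<K}"
  shows "inst \<sigma> \<in> instances N lam"
proof -
  let ?u = "monopolist_utility (inst \<sigma>) ` {..<N}"
  have pos: "V / lam > 0" using V_ge_1 lam by simp
  have fin: "finite ?u" "?u \<noteq> {}" using N_pos by auto
  have "V / lam \<le> Min ?u" "Max ?u \<le> V"
    using fin monopolist_inst[OF \<sigma>] by auto
  then have "Max ?u / Min ?u \<le> V / (V / lam)"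
    using pos V_ge_1 by (intro frac_le) auto
  then have "balance_ratio N (inst \<sigma>) \<le> lam"
    using V_ge_1 lam by (simp add: balance_ratio_def)
  moreover have "monopolist_utility (inst \<sigma>) i > 0" if "i < N" for i
    using monopolist_inst(1)[OF \<sigma> that] pos by linarith
  ultimately show ?thesis by (simp add: instances_def valid_inst)
qed

text \<open>Up to its position \<open>t\<close>, an instance shows only which types drop out before stage \<open>t div m\<close>.\<close>

lemma take_inst_cong:
  assumes "t < K * m" and "\<And>j s. j < K \<Longrightarrow> s \<le> t div m \<Longrightarrow> s \<le> \<sigma> j \<longleftrightarrow> s \<le> \<tau> j"
  shows "take (Suc t) (inst \<sigma>) = take (Suc t) (inst \<tau>)"
proof (rule nth_equalityI)
  fix t' assume "t' < length (take (Suc t) (inst \<sigma>))"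
  then have t': "t' \<le> t" "t' < K * m" using assms by auto
  then have "t' div m \<le> t div m" by (simp add: div_le_mono)
  then show "take (Suc t) (inst \<sigma>) ! t' = take (Suc t) (inst \<tau>) ! t'"
    using t' K assms(2)[of "_ mod K" "t' div m"]
    by (auto simp: nth_inst stage_item_def fun_eq_iff)
qed simp

section \<open>Shares of indistinguishable types\<close>

abbreviation "perms \<equiv> {\<sigma>. \<sigma> permutes {..<K}}"

lemma finite_perms: "finite perms"
  by (simp add: finite_permutations)

lemma card_perms: "card perms = fact K"
  by (simp add: card_permutations)

lemma allocation_sum_le:
  assumes A: "deterministic_online_algorithm N A" and t: "t \<le> K * m"
  shows "(\<Sum>i<N. run A (inst \<sigma>) i t) \<le> 1"
proof -
  have "allocation N (inst \<sigma>) (run A (inst \<sigma>))"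
    using A valid_inst by (simp add: deterministic_online_algorithm_def)
  then show ?thesis
    using t supply_inst[OF t] by (auto simp: allocation_def less_Suc_eq_le)
qed

lemma allocation_nonneg:
  assumes A: "deterministic_online_algorithm N A" and t: "t \<le> K * m" and i: "i < N"
  shows "run A (inst \<sigma>) i t \<ge> 0"
  using A valid_inst t i
  by (auto simp: deterministic_online_algorithm_def allocation_def)

lemma agent_less: "g < m \<Longrightarrow> j < K \<Longrightarrow> g * K + j < N"
  using pair_less mK_le order_less_le_trans by blast

text \<open>Divided by \<open>fact K\<close>, this is the expected amount of the stage
  \<open>s\<close> item of group \<open>g\<close> that goes to the type with last stage
  \<open>p\<close>, for uniformly random \<open>\<sigma>\<close>.\<close>

definition share :: "strategy \<Rightarrow> nat \<Rightarrow> nat \<Rightarrow> nat \<Rightarrow> real" where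
  "share A g s p = (\<Sum>\<sigma>\<in>perms. \<Sum>j<K. if \<sigma> j = p then run A (inst \<sigma>) (g * K + j) (s * m + g) else 0)"

text \<open>
  At stage \<open>s\<close> the types that are still present are indistinguishable, so exchanging the
  positions \<open>s\<close> and \<open>p\<close> does not change the decision.
\<close>

lemma share_eq:
  assumes g: "g < m" and s: "s \<le> p" and p: "p < K"
  shows "share A g s p = share A g s s"
proof -
  let ?\<tau> = "Transposition.transpose s p"
  have \<tau>: "?\<tau> permutes {..<K}"
    using s p by (intro permutes_swap_id) auto
  \<comment> \<open>Both \<open>s\<close> and \<open>p\<close> are at least \<open>s'\<close>, so
    exchanging them moves no position across \<open>s'\<close>.\<close>
  have ge: "s' \<le> ?\<tau> q \<longleftrightarrow> s' \<le> q" if "s' \<le> s" for s' q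
    using that s by (auto simp: Transposition.transpose_def)
  have "run A (inst (?\<tau> \<circ> \<sigma>)) i (s * m + g) = run A (inst \<sigma>) i (s * m + g)" for \<sigma> i
  proof -
    have "take (Suc (s * m + g)) (inst (?\<tau> \<circ> \<sigma>)) = take (Suc (s * m + g)) (inst \<sigma>)"
      using s p g by (intro take_inst_cong) (simp_all add: ge pair_less)
    then show ?thesis by (simp add: run_def)
  qed
  moreover have "?\<tau> q = p \<longleftrightarrow> q = s" for q
    by (auto simp: Transposition.transpose_def)
  ultimately show ?thesis
    unfolding share_def by (subst setum_permutations_compose_left[OF \<tau>]) (simp cong: if_cong)
qed

text \<open>By \<open>share_eq\<close> the \<open>K - s\<close> positions from \<open>s\<close> on
  have equal shares, and for each of the \<open>fact K\<close> orders these add up to at most one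
  unit. Weakening \<open>K - s\<close> to \<open>K - p\<close> makes the bound independent of
  \<open>s\<close>.\<close>

lemma share_le:
  assumes A: "deterministic_online_algorithm N A" and g: "g < m" and s: "s \<le> p" and p: "p < K"
  shows "share A g s p \<le> fact K / (K - p)"
proof -
  let ?x = "\<lambda>\<sigma> j. run A (inst \<sigma>) (g * K + j) (s * m + g)"
  have t: "s * m + g \<le> K * m" using pair_less[of s K g m] s p g by simp
  have x0: "?x \<sigma> j \<ge> 0" if "j < K" for \<sigma> j
    using allocation_nonneg[OF A t agent_less[OF g that]] .
  have x1: "(\<Sum>j<K. ?x \<sigma> j) \<le> 1" for \<sigma>
  proof -
    have "(\<Sum>j<K. ?x \<sigma> j) = (\<Sum>i\<in>(\<lambda>j. g * K + j) ` {..<K}. run A (inst \<sigma>) i (s * m + g))"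
      by (subst sum.reindex) auto
    also have "\<dots> \<le> (\<Sum>i<N. run A (inst \<sigma>) i (s * m + g))"
      using agent_less[OF g] allocation_nonneg[OF A t] by (intro sum_mono2) auto
    also have "\<dots> \<le> 1" by (rule allocation_sum_le[OF A t])
    finally show ?thesis .
  qed
  have "share A g s q = share A g s p" if "q \<in> {s..<K}" for q
    using share_eq[OF g, of s q] share_eq[OF g s p] that by simp
  then have "(K - s) * share A g s p = (\<Sum>q\<in>{s..<K}. share A g s q)"
    by simp
  also have "\<dots> = (\<Sum>\<sigma>\<in>perms. \<Sum>q\<in>{s..<K}. \<Sum>j<K. if \<sigma> j = q then ?x \<sigma> j else 0)"
    unfolding share_def by (rule sum.swap)
  also have "\<dots> = (\<Sum>\<sigma>\<in>perms. \<Sum>j<K. \<Sum>q\<in>{s..<K}. if \<sigma> j = q then ?x \<sigma> j else 0)"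
    by (intro sum.cong refl sum.swap)
  also have "\<dots> = (\<Sum>\<sigma>\<in>perms. \<Sum>j<K. if \<sigma> j \<in> {s..<K} then ?x \<sigma> j else 0)"
    by simp
  also have "\<dots> \<le> (\<Sum>\<sigma>\<in>perms. \<Sum>j<K. ?x \<sigma> j)"
    using x0 by (intro sum_mono) auto
  also have "\<dots> \<le> (\<Sum>\<sigma>\<in>perms. 1)"
    by (intro sum_mono x1)
  also have "\<dots> = fact K" using card_perms by simp
  finally have "share A g s p \<le> fact K / (K - s)"
    using s p by (simp add: field_simps of_nat_diff)
  also have "\<dots> \<le> fact K / (K - p)"
    using s p by (intro divide_left_mono) (auto simp: of_nat_diff)
  finally show ?thesis .
qed

section \<open>An offline allocation\<close>

definition opt_utility :: "(nat \<Rightarrow> nat) \<Rightarrow> nat \<Rightarrow> real" where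
  "opt_utility \<sigma> i = (if i < m * K then real K ^ \<sigma> (i mod K) else V / (N - m * K))"

text \<open>The witness that bounds the optimum from below. If \<open>N = m * K\<close>, the
  quotient is \<open>0\<close> by convention, but then no agent \<open>i < N\<close> reaches that
  branch.\<close>

definition opt_allocation :: "(nat \<Rightarrow> nat) \<Rightarrow> nat \<Rightarrow> nat \<Rightarrow> real" where
  "opt_allocation \<sigma> i t =
    (if t < K * m then if i < m * K \<and> i div K = t mod m \<and> \<sigma> (i mod K) = t div m then 1 else 0
     else if m * K \<le> i then 1 / (N - m * K) else 0)"

lemma sum_agents:
  "(\<Sum>i<N. h i) = (\<Sum>g<m. \<Sum>j<K. h (g * K + j)) + (\<Sum>i\<in>{m * K..<N}. h i)"
  for h :: "nat \<Rightarrow> real"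
proof -
  have "(\<Sum>i<N. h i) = (\<Sum>i<m * K. h i) + (\<Sum>i\<in>{m * K..<N}. h i)"
    using mK_le by (metis atLeast0LessThan sum.atLeastLessThan_concat zero_le)
  then show ?thesis by (simp add: sum_nat_less_mult)
qed

text \<open>As \<open>\<sigma>\<close> is a bijection, exactly one type has a given last stage, so
  every stage item is claimed once.\<close>

lemma allocation_opt:
  assumes \<sigma>: "\<sigma> permutes {..<K}"
  shows "allocation N (inst \<sigma>) (opt_allocation \<sigma>)"
  unfolding allocation_def
proof (intro allI impI conjI)
  fix t assume t: "t < length (inst \<sigma>)"
  show "opt_allocation \<sigma> i t \<ge> 0" for i
    by (simp add: opt_allocation_def)
  have "(\<Sum>i<N. opt_allocation \<sigma> i t) \<le> 1"
  proof (cases "t < K * m")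
    case True
    have "(\<Sum>i<N. opt_allocation \<sigma> i t) =
        (\<Sum>g<m. \<Sum>j<K. if g = t mod m then if \<sigma> j = t div m then 1 else 0 else 0)"
      using True by (simp add: sum_agents opt_allocation_def pair_less)
        (intro sum.cong refl, simp add: pair_less)
    also have "\<dots> = (\<Sum>j<K. if \<sigma> j = t div m then 1 else 0)"
      using m by (subst sum.swap) simp
    also have "\<dots> = (\<Sum>p<K. if p = t div m then 1 else 0)"
      by (subst sum.permute[OF \<sigma>, of "\<lambda>p. if p = t div m then 1 else 0"]) (simp add: o_def)
    also have "\<dots> \<le> 1" by simp
    finally show ?thesis .
  next
    case False
    have "opt_allocation \<sigma> (g * K + j) t = 0" if "g < m" "j < K" for g j
      using False pair_less[OF that] by (simp add: opt_allocation_def)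
    then have "(\<Sum>g<m. \<Sum>j<K. opt_allocation \<sigma> (g * K + j) t) = 0"
      by simp
    moreover have "(\<Sum>i\<in>{m * K..<N}. opt_allocation \<sigma> i t) \<le> 1"
      using False by (simp add: opt_allocation_def del: of_nat_diff)
    ultimately show ?thesis
      by (simp add: sum_agents)
  qed
  then show "(\<Sum>i<N. opt_allocation \<sigma> i t) \<le> item_supply (inst \<sigma> ! t)"
    using t by (simp add: supply_inst)
qed

lemma utility_opt:
  assumes \<sigma>: "\<sigma> permutes {..<K}" and i: "i < N"
  shows "utility (inst \<sigma>) (opt_allocation \<sigma>) i = opt_utility \<sigma> i"
  using i
proof (cases i rule: agent_cases)
  case (1 g j)
  then have i: "g * K + j < m * K" by (simp add: pair_less)
  have \<sigma>j: "\<sigma> j < K" using permutes_in_image[OF \<sigma>, of j] 1 by simp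
  have "(\<Sum>s\<le>\<sigma> j. opt_allocation \<sigma> (g * K + j) (s * m + g) * real K ^ s) =
      (\<Sum>s\<le>\<sigma> j. if s = \<sigma> j then real K ^ s else 0)"
    using 1 i \<sigma>j by (intro sum.cong) (auto simp: opt_allocation_def pair_less)
  moreover have "opt_allocation \<sigma> (g * K + j) (K * m) = 0"
    using i by (simp add: opt_allocation_def)
  ultimately show ?thesis
    using 1 i by (simp add: utility_type[OF \<sigma>] opt_utility_def)
next
  case 2
  then show ?thesis
    using i by (simp add: utility_rest opt_allocation_def opt_utility_def)
qed

lemma opt_utility_pos: "i < N \<Longrightarrow> opt_utility \<sigma> i > 0"
proof (cases "i < m * K")
  case False
  moreover assume "i < N"
  ultimately have "m * K < N" by linarith
  then have "real (N - m * K) > 0" by (simp del: of_nat_diff of_nat_mult)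
  then show ?thesis
    using False V_ge_1 by (simp add: opt_utility_def del: of_nat_diff of_nat_mult)
qed (use K in \<open>simp add: opt_utility_def\<close>)

lemma W_le: "W p * (real K - 1) \<le> real K ^ Suc p"
  by (induction p) (auto simp: W_def algebra_simps)

text \<open>A geometric sum is dominated by its last term. The growth factor \<open>K\<close> keeps
  the loss so small that it only turns \<open>K / e\<close> into \<open>(K - 1) / e\<close>.\<close>

lemma W_div_le: "W p / real K ^ p \<le> K / (real K - 1)"
  using W_le[of p] K by (simp add: field_simps)

end

section \<open>The weighted mean inequality\<close>

text \<open>\<open>\<alpha>\<close> bounds the gain of an online algorithm over the fraction
  \<open>1 / (K - p)\<close> of the offline utility: the first summand accounts for all stage items,
  the second for the single unit of the balancing item, spread over \<open>m\<close> groups.\<close>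

locale hard_instance_scaled = hard_instance +
  fixes \<alpha> :: real
  assumes \<alpha>: "\<alpha> \<ge> K / (real K - 1) + max 0 (V / lam - 1) / m"
begin

lemma \<alpha>_pos: "\<alpha> > 0"
proof -
  have "K / (real K - 1) > 0" using K by simp
  moreover have "max 0 (V / lam - 1) / m \<ge> 0" by simp
  ultimately show ?thesis using \<alpha> by linarith
qed

text \<open>
  The weights of the arithmetic-geometric mean inequality, which bound the utilities that an
  online algorithm can achieve on average over \<open>\<sigma>\<close>.
\<close>

definition weight :: "(nat \<Rightarrow> nat) \<Rightarrow> nat \<Rightarrow> real" where
  "weight \<sigma> i = opt_utility \<sigma> i * (if i < m * K then \<alpha> / (K - \<sigma> (i mod K)) else 1)"

lemma weight_pos:
  assumes \<sigma>: "\<sigma> permutes {..<K}" and i: "i < N"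
  shows "weight \<sigma> i > 0"
proof -
  have "\<sigma> (i mod K) < K"
    using permutes_in_image[OF \<sigma>, of "i mod K"] K by simp
  then show ?thesis
    using \<alpha>_pos opt_utility_pos[OF i] by (simp add: weight_def)
qed

text \<open>\<open>\<sigma>\<close> only permutes the factors \<open>K - p\<close>, whose product is
  \<open>fact K\<close> in each group. Hence the quotient of the two products is the same for all
  \<open>\<sigma>\<close>.\<close>

lemma prod_weight:
  assumes \<sigma>: "\<sigma> permutes {..<K}"
  shows "(\<Prod>i<N. weight \<sigma> i) = (\<Prod>i<N. opt_utility \<sigma> i) * (\<alpha> ^ K / fact K) ^ m"
proof -
  have "(\<Prod>i<N. if i < m * K then \<alpha> / (K - \<sigma> (i mod K)) else 1) =
      (\<Prod>i<m * K. \<alpha> / (K - \<sigma> (i mod K)))"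
    using mK_le by (intro prod.mono_neutral_cong_right) auto
  also have "\<dots> = (\<Prod>j<K. \<alpha> / (K - \<sigma> j)) ^ m"
    by (rule prod_mod_less_mult)
  also have "(\<Prod>j<K. \<alpha> / (K - \<sigma> j)) = (\<Prod>p<K. \<alpha> / (K - p))"
    by (subst prod.permute[OF \<sigma>, of "\<lambda>p. \<alpha> / (K - p)"]) (simp add: o_def)
  also have "\<dots> = \<alpha> ^ K / (\<Prod>p<K. real (K - p))"
    by (simp add: prod_dividef)
  also have "(\<Prod>p<K. real (K - p)) = fact K"
    by (simp add: fact_prod_rev atLeast0LessThan)
  finally show ?thesis
    by (simp add: weight_def prod.distrib)
qed

text \<open>Sorting by last stage \<open>p\<close> and stage \<open>s\<close> brings out
  \<open>share A g s p\<close>. The factor \<open>K - p\<close> of the inverse weight cancels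
  against \<open>share_le\<close>, and a geometric sum remains for each \<open>p\<close>.\<close>

lemma sum_stage_shares_le:
  assumes A: "deterministic_online_algorithm N A" and g: "g < m"
  shows "(\<Sum>\<sigma>\<in>perms. \<Sum>j<K. \<Sum>s\<le>\<sigma> j. run A (inst \<sigma>) (g * K + j) (s * m + g) *
      (real K ^ s * (K - \<sigma> j) / (\<alpha> * real K ^ \<sigma> j)))
    \<le> fact K * (K * (K / (real K - 1)) / \<alpha>)" (is "?L \<le> _")
proof -
  define w where "w s p = real K ^ s * (K - p) / (\<alpha> * real K ^ p)" for s p
  define x where "x \<sigma> j s = run A (inst \<sigma>) (g * K + j) (s * m + g)" for \<sigma> j s
  have "?L = (\<Sum>\<sigma>\<in>perms. \<Sum>j<K. \<Sum>p<K. if \<sigma> j = p then \<Sum>s\<le>p. x \<sigma> j s * w s p else 0)"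
  proof (rule sum.cong[OF refl], rule sum.cong[OF refl])
    fix \<sigma> j assume \<sigma>: "\<sigma> \<in> perms" and j: "j \<in> {..<K}"
    have "\<sigma> j < K" using permutes_in_image[of \<sigma> "{..<K}" j] \<sigma> j by simp
    then show "(\<Sum>s\<le>\<sigma> j. run A (inst \<sigma>) (g * K + j) (s * m + g) *
        (real K ^ s * (K - \<sigma> j) / (\<alpha> * real K ^ \<sigma> j))) =
      (\<Sum>p<K. if \<sigma> j = p then \<Sum>s\<le>p. x \<sigma> j s * w s p else 0)"
      by (simp add: x_def w_def)
  qed
  also have "\<dots> = (\<Sum>\<sigma>\<in>perms. \<Sum>p<K. \<Sum>j<K. if \<sigma> j = p then \<Sum>s\<le>p. x \<sigma> j s * w s p else 0)"
    by (intro sum.cong refl sum.swap)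
  also have "\<dots> = (\<Sum>p<K. \<Sum>\<sigma>\<in>perms. \<Sum>j<K. if \<sigma> j = p then \<Sum>s\<le>p. x \<sigma> j s * w s p else 0)"
    by (rule sum.swap)
  also have "\<dots> = (\<Sum>p<K. \<Sum>\<sigma>\<in>perms. \<Sum>j<K. \<Sum>s\<le>p. w s p * (if \<sigma> j = p then x \<sigma> j s else 0))"
    by (intro sum.cong refl) (simp add: mult.commute)
  also have "\<dots> = (\<Sum>p<K. \<Sum>\<sigma>\<in>perms. \<Sum>s\<le>p. \<Sum>j<K. w s p * (if \<sigma> j = p then x \<sigma> j s else 0))"
    by (intro sum.cong refl sum.swap)
  also have "\<dots> = (\<Sum>p<K. \<Sum>s\<le>p. \<Sum>\<sigma>\<in>perms. \<Sum>j<K. w s p * (if \<sigma> j = p then x \<sigma> j s else 0))"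
    by (intro sum.cong refl sum.swap)
  also have "\<dots> = (\<Sum>p<K. \<Sum>s\<le>p. w s p * share A g s p)"
    unfolding share_def x_def by (simp only: sum_distrib_left)
  also have "\<dots> \<le> (\<Sum>p<K. \<Sum>s\<le>p. w s p * (fact K / (K - p)))"
    using \<alpha>_pos by (intro sum_mono mult_left_mono share_le A g) (auto simp: w_def)
  also have "\<dots> = (\<Sum>p<K. fact K / \<alpha> * (W p / real K ^ p))"
  proof (intro sum.cong refl)
    fix p assume "p \<in> {..<K}"
    then have "w s p * (fact K / (K - p)) = fact K / \<alpha> / real K ^ p * real K ^ s" for s
      using \<alpha>_pos K by (simp add: w_def)
    then have "(\<Sum>s\<le>p. w s p * (fact K / (K - p))) = fact K / \<alpha> / real K ^ p * W p"
      by (simp only: W_def sum_distrib_left)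
    then show "(\<Sum>s\<le>p. w s p * (fact K / (K - p))) = fact K / \<alpha> * (W p / real K ^ p)"
      by simp
  qed
  also have "\<dots> \<le> (\<Sum>p<K. fact K / \<alpha> * (K / (real K - 1)))"
    using \<alpha>_pos by (intro sum_mono mult_left_mono W_div_le) auto
  also have "\<dots> = fact K * (K * (K / (real K - 1)) / \<alpha>)"
    by (simp add: mult_ac)
  finally show ?thesis .
qed

lemma utility_type_div_weight_le:
  assumes \<sigma>: "\<sigma> permutes {..<K}" and g: "g < m" and j: "j < K"
    and x: "x (g * K + j) (K * m) \<ge> 0"
  shows "utility (inst \<sigma>) x (g * K + j) / weight \<sigma> (g * K + j) \<le>
    (\<Sum>s\<le>\<sigma> j. x (g * K + j) (s * m + g) * (real K ^ s * (K - \<sigma> j) / (\<alpha> * real K ^ \<sigma> j))) +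
    x (g * K + j) (K * m) * (max 0 (V / lam - 1) * K / \<alpha>)"
proof -
  let ?i = "g * K + j"
  have \<sigma>j: "\<sigma> j < K" using permutes_in_image[OF \<sigma>, of j] j by simp
  have "?i < m * K" using g j by (simp add: pair_less)
  then have w: "1 / weight \<sigma> ?i = (K - \<sigma> j) / (\<alpha> * real K ^ \<sigma> j)"
    using j by (simp add: weight_def opt_utility_def mult.commute)
  have "utility (inst \<sigma>) x ?i / weight \<sigma> ?i = utility (inst \<sigma>) x ?i * (1 / weight \<sigma> ?i)"
    by simp
  also have "\<dots> = (\<Sum>s\<le>\<sigma> j. x ?i (s * m + g) * (real K ^ s * (K - \<sigma> j) / (\<alpha> * real K ^ \<sigma> j))) +
      x ?i (K * m) * (bal (\<sigma> j) * ((K - \<sigma> j) / (\<alpha> * real K ^ \<sigma> j)))"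
    unfolding w utility_type[OF \<sigma> g j]
    by (simp add: algebra_simps sum_distrib_left sum_divide_distrib)
  \<comment> \<open>The worst type is the one with \<open>\<sigma> j = 0\<close>: it has the largest
    \<open>bal\<close> and the largest \<open>(K - p) / K ^ p\<close>.\<close>
  also have "bal (\<sigma> j) * ((K - \<sigma> j) / (\<alpha> * real K ^ \<sigma> j)) \<le> max 0 (V / lam - 1) * (K / (\<alpha> * 1))"
    using \<alpha>_pos K bal_nonneg
    by (intro mult_mono bal_le frac_le mult_left_mono one_le_power) auto
  finally show ?thesis
    using x by (simp add: mult_left_mono)
qed

text \<open>For the \<open>m * K\<close> agents with a type, \<open>\<alpha>\<close> covers the
  stage items and the balancing item together. The other agents add at most
  \<open>N - m * K\<close>, since each has as weight an equal part of \<open>V\<close>.\<close>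

lemma sum_utility_div_weight_le:
  assumes A: "deterministic_online_algorithm N A"
  shows "(\<Sum>\<sigma>\<in>perms. \<Sum>i<N. utility (inst \<sigma>) (run A (inst \<sigma>)) i / weight \<sigma> i) \<le> N * fact K"
proof -
  define \<beta> where "\<beta> = max 0 (V / lam - 1)"
  define x where "x \<sigma> = run A (inst \<sigma>)" for \<sigma>
  define T where "T \<sigma> g j = (\<Sum>s\<le>\<sigma> j. x \<sigma> (g * K + j) (s * m + g) *
      (real K ^ s * (K - \<sigma> j) / (\<alpha> * real K ^ \<sigma> j)))" for \<sigma> g j
  have eq: "(\<Sum>g<m. fact K * (K * \<kappa> / \<alpha>)) + fact K * (\<beta> * K / \<alpha> + (N - m * K)) =
      fact K * (m * K * (\<kappa> + \<beta> / m) / \<alpha> + (N - m * K))" for \<kappa> :: real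
    using m \<alpha>_pos by (simp add: field_simps del: of_nat_diff)
  have \<beta>0: "\<beta> \<ge> 0" by (simp add: \<beta>_def)
  have nn: "x \<sigma> i (K * m) \<ge> 0" if "i < N" for \<sigma> i
    unfolding x_def by (rule allocation_nonneg[OF A _ that]) simp
  have x1: "(\<Sum>g<m. \<Sum>j<K. x \<sigma> (g * K + j) (K * m)) + (\<Sum>i\<in>{m * K..<N}. x \<sigma> i (K * m)) \<le> 1" for \<sigma>
    using allocation_sum_le[OF A, of "K * m" \<sigma>] by (simp add: x_def sum_agents)
  \<comment> \<open>The unit of the balancing item is counted in full twice, here and in
    \<open>rest\<close>.\<close>
  have types: "(\<Sum>g<m. \<Sum>j<K. x \<sigma> (g * K + j) (K * m)) \<le> 1" for \<sigma>
    using x1[of \<sigma>] nn sum_nonneg[of "{m * K..<N}" "\<lambda>i. x \<sigma> i (K * m)"] by fastforce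
  have rest: "(\<Sum>i\<in>{m * K..<N}. x \<sigma> i (K * m)) \<le> 1" for \<sigma>
  proof -
    have "(\<Sum>g<m. \<Sum>j<K. x \<sigma> (g * K + j) (K * m)) \<ge> 0"
      using nn agent_less by (intro sum_nonneg) auto
    then show ?thesis using x1[of \<sigma>] by linarith
  qed
  have "(\<Sum>i<N. utility (inst \<sigma>) (x \<sigma>) i / weight \<sigma> i) \<le>
      (\<Sum>g<m. \<Sum>j<K. T \<sigma> g j) + \<beta> * K / \<alpha> + (N - m * K)" if \<sigma>: "\<sigma> permutes {..<K}" for \<sigma>
  proof -
    have "(\<Sum>g<m. \<Sum>j<K. utility (inst \<sigma>) (x \<sigma>) (g * K + j) / weight \<sigma> (g * K + j)) \<le>
        (\<Sum>g<m. \<Sum>j<K. T \<sigma> g j + x \<sigma> (g * K + j) (K * m) * (\<beta> * K / \<alpha>))"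
      unfolding T_def \<beta>_def
      using nn agent_less by (intro sum_mono utility_type_div_weight_le[OF \<sigma>]) auto
    also have "\<dots> = (\<Sum>g<m. \<Sum>j<K. T \<sigma> g j) +
        (\<Sum>g<m. \<Sum>j<K. x \<sigma> (g * K + j) (K * m)) * (\<beta> * K / \<alpha>)"
      by (simp only: sum.distrib sum_distrib_right)
    also have "\<dots> \<le> (\<Sum>g<m. \<Sum>j<K. T \<sigma> g j) + 1 * (\<beta> * K / \<alpha>)"
      using \<beta>0 \<alpha>_pos by (intro add_left_mono mult_right_mono types) auto
    finally have 1: "(\<Sum>g<m. \<Sum>j<K. utility (inst \<sigma>) (x \<sigma>) (g * K + j) / weight \<sigma> (g * K + j)) \<le>
        (\<Sum>g<m. \<Sum>j<K. T \<sigma> g j) + \<beta> * K / \<alpha>" by simp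
    have "(\<Sum>i\<in>{m * K..<N}. utility (inst \<sigma>) (x \<sigma>) i / weight \<sigma> i) =
        (\<Sum>i\<in>{m * K..<N}. (N - m * K) * x \<sigma> i (K * m))"
      using V_ge_1 by (intro sum.cong) (auto simp: utility_rest weight_def opt_utility_def)
    also have "\<dots> = (N - m * K) * (\<Sum>i\<in>{m * K..<N}. x \<sigma> i (K * m))"
      by (simp add: sum_distrib_left)
    also have "\<dots> \<le> (N - m * K)"
      by (intro mult_left_le rest) auto
    finally show ?thesis using 1 by (simp add: sum_agents)
  qed
  then have "(\<Sum>\<sigma>\<in>perms. \<Sum>i<N. utility (inst \<sigma>) (x \<sigma>) i / weight \<sigma> i) \<le>
      (\<Sum>\<sigma>\<in>perms. (\<Sum>g<m. \<Sum>j<K. T \<sigma> g j) + \<beta> * K / \<alpha> + (N - m * K))"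
    by (intro sum_mono) simp
  also have "\<dots> = (\<Sum>\<sigma>\<in>perms. \<Sum>g<m. \<Sum>j<K. T \<sigma> g j) + fact K * (\<beta> * K / \<alpha> + (N - m * K))"
    by (simp add: sum.distrib card_perms algebra_simps)
  also have "(\<Sum>\<sigma>\<in>perms. \<Sum>g<m. \<Sum>j<K. T \<sigma> g j) = (\<Sum>g<m. \<Sum>\<sigma>\<in>perms. \<Sum>j<K. T \<sigma> g j)"
    by (rule sum.swap)
  also have "\<dots> \<le> (\<Sum>g<m. fact K * (K * (K / (real K - 1)) / \<alpha>))"
    unfolding T_def x_def using sum_stage_shares_le[OF A] by (intro sum_mono) auto
  also have "\<dots> + fact K * (\<beta> * K / \<alpha> + (N - m * K)) =
      fact K * (m * K * (K / (real K - 1) + \<beta> / m) / \<alpha> + (N - m * K))"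
    by (subst eq) simp
  also have "\<dots> \<le> fact K * (m * K * \<alpha> / \<alpha> + (N - m * K))"
    using \<alpha> \<alpha>_pos unfolding \<beta>_def
    by (intro mult_left_mono add_right_mono divide_right_mono) auto
  also have "\<dots> = N * fact K"
    using \<alpha>_pos mK_le by (simp add: of_nat_diff)
  finally show ?thesis by (simp add: x_def)
qed

text \<open>The geometric mean of the weights is \<open>Q \<sigma> / \<rho>\<close> for every
  \<open>\<sigma>\<close>, and the ratios of utility to weight average at most \<open>1\<close>. So
  the welfare is on average at most \<open>1 / \<rho>\<close> of \<open>Q \<sigma>\<close>, and
  Yao's principle applies.\<close>

theorem worst_case_ratio_ge:
  assumes M: "online_algorithm N M"
  shows "ennreal (root N ((fact K / \<alpha> ^ K) ^ m)) \<le> worst_case_ratio N lam M"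
proof -
  define Q where "Q \<sigma> = root N (\<Prod>i<N. opt_utility \<sigma> i)" for \<sigma>
  define \<rho> where "\<rho> = root N ((fact K / \<alpha> ^ K) ^ m)"
  have \<rho>: "\<rho> > 0"
    using \<alpha>_pos N_pos by (simp add: \<rho>_def)
  have inv: "root N ((\<alpha> ^ K / fact K) ^ m) = 1 / \<rho>"
    using \<alpha>_pos N_pos by (simp add: \<rho>_def power_divide real_root_divide)
  have Q: "Q \<sigma> > 0" for \<sigma>
    unfolding Q_def using N_pos opt_utility_pos by (intro real_root_gt_zero prod_pos) auto
  have "ennreal \<rho> \<le> worst_case_ratio N lam M"
  proof (rule worst_case_ratio_ge_average[where S = perms and I = inst and Q = Q])
    show "perms \<noteq> {}" using permutes_id by blast
    show "\<exists>x. allocation N (inst \<sigma>) x \<and> Q \<sigma> \<le> nash_welfare N (inst \<sigma>) x"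
      if "\<sigma> \<in> perms" for \<sigma>
    proof (intro exI conjI)
      show "allocation N (inst \<sigma>) (opt_allocation \<sigma>)"
        using that by (simp add: allocation_opt)
      show "Q \<sigma> \<le> nash_welfare N (inst \<sigma>) (opt_allocation \<sigma>)"
        using that by (simp add: Q_def nash_welfare_def utility_opt)
    qed
  next
    fix A assume A: "deterministic_online_algorithm N A"
    let ?u = "\<lambda>\<sigma>. utility (inst \<sigma>) (run A (inst \<sigma>))"
    have "nash_welfare N (inst \<sigma>) (run A (inst \<sigma>)) / Q \<sigma> \<le>
        1 / (\<rho> * N) * (\<Sum>i<N. ?u \<sigma> i / weight \<sigma> i)" if "\<sigma> \<in> perms" for \<sigma>
    proof -
      have \<sigma>: "\<sigma> permutes {..<K}" using that by simp
      have "allocation N (inst \<sigma>) (run A (inst \<sigma>))"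
        using A valid_inst by (simp add: deterministic_online_algorithm_def)
      then have "nash_welfare N (inst \<sigma>) (run A (inst \<sigma>)) \<le>
          root N (\<Prod>i<N. weight \<sigma> i) * ((\<Sum>i<N. ?u \<sigma> i / weight \<sigma> i) / N)"
        unfolding nash_welfare_def
        using weight_pos[OF \<sigma>] utility_nonneg[OF valid_inst]
        by (intro root_prod_le_weighted_mean N_pos) auto
      also have "root N (\<Prod>i<N. weight \<sigma> i) = Q \<sigma> / \<rho>"
        unfolding prod_weight[OF \<sigma>] real_root_mult inv Q_def by simp
      finally show ?thesis
        using Q[of \<sigma>] by (simp add: field_simps)
    qed
    then have "(\<Sum>\<sigma>\<in>perms. nash_welfare N (inst \<sigma>) (run A (inst \<sigma>)) / Q \<sigma>) \<le>
        1 / (\<rho> * N) * (\<Sum>\<sigma>\<in>perms. \<Sum>i<N. ?u \<sigma> i / weight \<sigma> i)"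
      unfolding sum_distrib_left[of _ _ perms] by (rule sum_mono)
    also have "\<dots> \<le> 1 / (\<rho> * N) * (N * fact K)"
      using \<rho> by (intro mult_left_mono sum_utility_div_weight_le A) auto
    also have "\<dots> = card perms / \<rho>"
      using N_pos card_perms by simp
    finally show "(\<Sum>\<sigma>\<in>perms. nash_welfare N (inst \<sigma>) (run A (inst \<sigma>)) / Q \<sigma>) \<le> card perms / \<rho>" .
  qed (use M N_pos \<rho> Q finite_perms inst_instances in auto)
  then show ?thesis by (simp add: \<rho>_def)
qed

end

section \<open>The two choices of parameters\<close>

lemma (in hard_instance) V_le: "V \<le> real K ^ K"
proof -
  have "V * 1 \<le> V * (real K - 1)"
    using K V_ge_1 by (intro mult_left_mono) auto
  also have "\<dots> \<le> real K ^ Suc (K - 1)"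
    unfolding V_def by (rule W_le)
  finally show ?thesis
    using K by simp
qed

text \<open>A single group with \<open>K = N\<close>. As \<open>V \<le> N ^ N \<le> lam\<close>,
  nobody values the balancing item, so \<open>\<alpha> = N / (N - 1)\<close> suffices.\<close>

lemma worst_case_ratio_ge_unbalanced:
  assumes M: "online_algorithm N M" and N: "N \<ge> 2" and lamN: "lam \<ge> real N ^ N"
  shows "ennreal ((real N - 1) / exp 1) \<le> worst_case_ratio N lam M"
proof -
  have lam1: "lam \<ge> 1"
    using lamN N one_le_power[of "real N" N] by linarith
  interpret hard_instance N N 1 lam
    by unfold_locales (use N lam1 in auto)
  define \<alpha> where "\<alpha> = N / (real N - 1)"
  have "V / lam - 1 \<le> 0"
    using V_le lamN lam1 by (simp add: field_simps)
  then interpret hard_instance_scaled N N 1 lam \<alpha>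
    by unfold_locales (simp add: \<alpha>_def max_def)
  have "(real N - 1) / exp 1 = root N (((real N - 1) / exp 1) ^ N)"
    using N by (simp add: real_root_power_cancel)
  also have "((real N - 1) / exp 1) ^ N = (real N / exp 1) ^ N / \<alpha> ^ N"
    using N by (simp add: \<alpha>_def power_divide)
  also have "root N \<dots> \<le> root N ((fact N / \<alpha> ^ N) ^ 1)"
    using N \<alpha>_pos by (simp add: divide_right_mono fact_ge_power_div_exp)
  finally show ?thesis
    using worst_case_ratio_ge[OF M] ennreal_leI order_trans by blast
qed

text \<open>\<open>Nlam\<close> gives \<open>V \<le> m * lam\<close>, so the balancing item adds at
  most \<open>1\<close> to \<open>\<alpha>\<close>, and \<open>\<alpha> = 3\<close> will do.
  \<open>KN\<close> limits the loss from the fewer than \<open>K\<close> left-over agents to the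
  factor \<open>exp (- 2)\<close>.\<close>

lemma worst_case_ratio_ge_grouped:
  assumes M: "online_algorithm N M" and lam: "lam \<ge> 1"
    and K9: "K \<ge> 9" and K_le: "K \<le> N" and Nlam: "2 * real K ^ Suc K \<le> real N * lam"
    and KN: "K * ln K \<le> 2 * real N"
  shows "ennreal (K / (3 * exp 3)) \<le> worst_case_ratio N lam M"
proof -
  define m where "m = N div K"
  \<comment> \<open>Chosen so that \<open>b ^ K \<le> fact K / 3 ^ K\<close>.\<close>
  define b where "b = K / (3 * exp 1)"
  have m: "m \<ge> 1"
    using K9 K_le by (simp add: m_def div_greater_zero_iff Suc_le_eq)
  have mK: "m * K \<le> N" "N < m * K + K"
    unfolding m_def using div_mult_mod_eq[of N K] mod_less_divisor[of K N] K9 by linarith+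
  interpret hard_instance N K m lam
    by unfold_locales (use K9 m mK lam in auto)
  have "real N \<le> 2 * K * m"
  proof -
    have "K \<le> m * K" using m by simp
    then have "N \<le> 2 * (m * K)" using mK(2) by linarith
    then have "real N \<le> real (2 * (m * K))" by (simp only: of_nat_le_iff)
    then show ?thesis by (simp add: mult_ac)
  qed
  then have "2 * real K ^ Suc K \<le> 2 * K * m * lam"
    using Nlam lam by (meson mult_right_mono order_trans zero_le_one)
  then have "real K ^ K \<le> m * lam"
    using K9 by simp
  then have "V \<le> m * lam"
    using V_le by linarith
  then have "max 0 (V / lam - 1) / m \<le> 1"
    using lam m by (simp add: field_simps)
  moreover have "K / (real K - 1) \<le> 2"
    using K9 by (simp add: field_simps)
  ultimately interpret hard_instance_scaled N K m lam 3
    by unfold_locales linarith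
  have "exp 1 \<le> (3::real)" by (rule exp_le)
  then have b1: "b \<ge> 1"
    using K9 by (simp add: b_def field_simps)
  have lnb: "ln b \<le> ln K"
  proof -
    have "b \<le> K / 1"
      unfolding b_def using K9 exp_ge_add_one_self[of 1] by (intro divide_left_mono) auto
    then show ?thesis using b1 by simp
  qed
  have "K / (3 * exp 3) = b * exp (- 2)"
    by (simp add: b_def exp_minus field_simps mult_exp_exp)
  \<comment> \<open>This pays for the exponent \<open>K * m / N\<close> below, which falls short of
    \<open>1\<close> by at most \<open>K / N\<close>.\<close>
  also have "\<dots> \<le> b * exp (- (K * ln b) / N)"
  proof -
    have "K * ln b \<le> K * ln K"
      using lnb by (intro mult_left_mono) auto
    then have "K * ln b \<le> 2 * real N"
      using KN by linarith
    then have "K * ln b / N \<le> 2"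
      using N_pos by (simp add: pos_divide_le_eq)
    then show ?thesis using b1 by simp
  qed
  also have "\<dots> = b powr (1 - K / N)"
    using b1 by (simp add: powr_def field_simps exp_add[symmetric] exp_diff)
  also have "\<dots> \<le> b powr (real (K * m) / N)"
  proof -
    have "real N \<le> real (K * m + K)"
      using mK(2) by (intro of_nat_mono) (simp add: mult.commute)
    then have "(real N - K) / N \<le> real (K * m) / N"
      by (intro divide_right_mono) auto
    then have "1 - K / N \<le> real (K * m) / N"
      using N_pos by (simp add: diff_divide_distrib)
    then show ?thesis using b1 by (intro powr_mono) auto
  qed
  also have "\<dots> = root N (b ^ (K * m))"
    using b1 N_pos by (simp add: root_powr_inverse powr_realpow[symmetric] powr_powr del: of_nat_mult)
  also have "b ^ (K * m) = ((K / exp 1) ^ K / 3 ^ K) ^ m"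
    by (simp add: b_def power_mult power_divide power_mult_distrib mult.commute)
  also have "root N \<dots> \<le> root N ((fact K / 3 ^ K) ^ m)"
    using N_pos by (simp add: power_mono divide_right_mono fact_ge_power_div_exp)
  finally show ?thesis
    using worst_case_ratio_ge[OF M] ennreal_leI order_trans by blast
qed

section \<open>Asymptotics of the logarithmic bound\<close>

text \<open>The exponent \<open>\<epsilon>\<close> as a function of \<open>L = ln (N * lam)\<close>; it makes \<open>L powr (1 - \<epsilon>)\<close> equal to \<open>L / (ln L)\<^sup>3\<close>.\<close>

definition log_defect :: "real \<Rightarrow> real" where
  "log_defect L = 3 * ln (ln L) / ln L"

text \<open>The group size \<open>K\<close> will be the integer part of
  \<open>L / (ln L)\<^sup>2\<close>. The third conjunct then yields
  \<open>2 * K ^ Suc K \<le> N * lam\<close>; the fourth holds because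
  \<open>L / (ln L)\<^sup>3\<close> has smaller order than \<open>K\<close>.\<close>

lemma eventually_group_size:
  "eventually (\<lambda>L::real. 2 \<le> ln L \<and> 10 \<le> L / (ln L)\<^sup>2 \<and>
     (L / (ln L)\<^sup>2 + 1) * ln L + ln 2 \<le> L \<and>
     L powr (1 - log_defect L) \<le> (L / (ln L)\<^sup>2 - 1) / (3 * exp 3)) at_top"
  unfolding log_defect_def by (intro eventually_conj; real_asymp)

text \<open>\<open>lam \<le> N ^ N\<close> forces \<open>L \<le> 2 * N * ln L\<close>. This bounds
  \<open>L / ln L\<close> by \<open>2 * N\<close>, and the second factor \<open>ln L\<close> in the
  group size gives \<open>K * ln K \<le> 2 * N\<close>.\<close>

lemma worst_case_ratio_ge_log:
  assumes M: "online_algorithm N M" and N: "N \<ge> 1" and lam: "lam \<ge> 1" "lam \<le> real N ^ N"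
    and L_def: "L = ln (real N * lam)"
    and L: "2 \<le> ln L" "10 \<le> L / (ln L)\<^sup>2" "(L / (ln L)\<^sup>2 + 1) * ln L + ln 2 \<le> L"
      "L powr (1 - log_defect L) \<le> (L / (ln L)\<^sup>2 - 1) / (3 * exp 3)"
  shows "ennreal (L powr (1 - log_defect L)) \<le> worst_case_ratio N lam M"
proof -
  define k where "k = L / (ln L)\<^sup>2"
  define K where "K = nat \<lfloor>k\<rfloor>"
  have k: "k \<ge> 10" using L by (simp add: k_def)
  then have K: "K \<le> k" "K > k - 1" "K \<ge> 9"
    unfolding K_def by linarith+
  have L0: "L > 0"
    using k divide_nonpos_nonneg[of L "(ln L)\<^sup>2"] by (force simp: k_def)
  have "k \<le> L / 1"
    unfolding k_def using L L0 by (intro divide_left_mono) auto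
  then have lnK: "ln K \<le> ln L"
    using K by simp
  \<comment> \<open>If \<open>L \<le> N\<close>, then \<open>ln L \<ge> 2\<close> suffices;
    otherwise \<open>ln N\<close> may be replaced by \<open>ln L\<close> in
    \<open>L \<le> (1 + N) * ln N\<close>.\<close>
  have LN: "L \<le> 2 * N * ln L"
  proof (cases "real N \<ge> L")
    case True
    then have "L * 1 \<le> real N * (2 * ln L)"
      using L L0 by (intro mult_mono) auto
    then show ?thesis by simp
  next
    case False
    then have lnN: "ln N \<le> ln L" "ln N \<ge> 0" using N by auto
    have "L \<le> ln (real N * real N ^ N)"
      unfolding L_def using N lam by simp
    also have "\<dots> = (1 + real N) * ln N"
      using N by (simp add: ln_mult ln_realpow algebra_simps)
    also have "\<dots> \<le> (2 * real N) * ln L"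
      using N lnN by (intro mult_mono) auto
    finally show ?thesis by simp
  qed
  have klnL: "k * ln L \<le> 2 * N"
    using LN L by (simp add: k_def power2_eq_square field_simps)
  have "k * 2 \<le> k * ln L"
    using k L by (intro mult_left_mono) auto
  then have KN: "K \<le> N"
    using klnL K by linarith
  have "K * ln K \<le> k * ln L"
    using K lnK k by (intro mult_mono) auto
  then have KlnK: "K * ln K \<le> 2 * real N"
    using klnL by linarith
  have "ln (2 * real K ^ Suc K) = ln 2 + (K + 1) * ln K"
    using K by (simp add: ln_mult ln_realpow algebra_simps)
  also have "\<dots> \<le> ln 2 + (k + 1) * ln L"
    using K lnK k by (intro add_left_mono mult_mono) auto
  also have "\<dots> \<le> ln (real N * lam)"
    using L by (simp add: k_def L_def)
  finally have "2 * real K ^ Suc K \<le> real N * lam"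
    using K N lam by (subst (asm) ln_le_cancel_iff) auto
  then have "ennreal (K / (3 * exp 3)) \<le> worst_case_ratio N lam M"
    using M lam K KN KlnK by (intro worst_case_ratio_ge_grouped) auto
  moreover have "L powr (1 - log_defect L) \<le> K / (3 * exp 3)"
  proof -
    have "(k - 1) / (3 * exp 3) \<le> K / (3 * exp 3)"
      using K by (intro divide_right_mono) auto
    then show ?thesis using L by (simp add: k_def)
  qed
  ultimately show ?thesis
    using ennreal_leI order_trans by blast
qed

theorem theorem7:
  "\<exists>\<epsilon> :: real \<Rightarrow> real. (\<epsilon> \<longlongrightarrow> 0) at_top \<and>
     (\<forall>(N::nat) (lam::real) M. N \<ge> 1 \<longrightarrow> lam \<ge> 1 \<longrightarrow> online_algorithm N M \<longrightarrow>
        ennreal (min (ln (real N * lam) powr (1 - \<epsilon> (real N * lam))) ((real N - 1) / exp 1))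
          \<le> worst_case_ratio N lam M)"
proof -
  obtain L0 where L0: "\<And>L. L \<ge> L0 \<Longrightarrow> 2 \<le> ln L \<and> 10 \<le> L / (ln L)\<^sup>2 \<and>
      (L / (ln L)\<^sup>2 + 1) * ln L + ln 2 \<le> L \<and>
      L powr (1 - log_defect L) \<le> (L / (ln L)\<^sup>2 - 1) / (3 * exp 3)"
    using eventually_group_size by (auto simp: eventually_at_top_linorder)
  \<comment> \<open>Below the threshold the value \<open>1\<close> makes the exponent
    \<open>0\<close>, so the bound to be shown is at most \<open>1\<close>.\<close>
  define \<epsilon> where "\<epsilon> z = (if ln z \<ge> L0 then log_defect (ln z) else 1)" for z
  have "eventually (\<lambda>z::real. ln z \<ge> L0) at_top"
    using ln_at_top by (simp add: filterlim_at_top)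
  then have eq: "eventually (\<lambda>z. \<epsilon> z = log_defect (ln z)) at_top"
    by eventually_elim (simp add: \<epsilon>_def)
  moreover have "((\<lambda>z. log_defect (ln z)) \<longlongrightarrow> 0) at_top"
    unfolding log_defect_def by real_asymp
  ultimately have "(\<epsilon> \<longlongrightarrow> 0) at_top"
    by (simp add: tendsto_cong[OF eq])
  moreover have "ennreal (min (ln (real N * lam) powr (1 - \<epsilon> (real N * lam))) ((real N - 1) / exp 1))
      \<le> worst_case_ratio N lam M"
    if N: "N \<ge> 1" and lam: "lam \<ge> 1" and M: "online_algorithm N M" for N lam M
  \<comment> \<open>From \<open>N ^ N\<close> on, the balance ratio permits a single group of all
    agents, which yields the second term of the minimum; below, the first term is reached.\<close>
  proof (cases "lam \<ge> real N ^ N")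
    case True
    have "ennreal ((real N - 1) / exp 1) \<le> worst_case_ratio N lam M"
    proof (cases "N = 1")
      case False
      then show ?thesis using worst_case_ratio_ge_unbalanced[OF M _ True] N by simp
    qed simp
    then show ?thesis
      by (meson ennreal_leI min.cobounded2 order_trans)
  next
    case False
    define L where "L = ln (real N * lam)"
    have "ennreal (L powr (1 - \<epsilon> (real N * lam))) \<le> worst_case_ratio N lam M"
    proof (cases "L \<ge> L0")
      case True
      then have "\<epsilon> (real N * lam) = log_defect L"
        by (simp add: \<epsilon>_def L_def)
      then show ?thesis
        using worst_case_ratio_ge_log[OF M N lam _ L_def] L0[OF True] False by simp
    next
      case False
      then have "L powr (1 - \<epsilon> (real N * lam)) \<le> 1"
        by (simp add: \<epsilon>_def L_def)
      then have "ennreal (L powr (1 - \<epsilon> (real N * lam))) \<le> 1"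
        by (metis ennreal_1 ennreal_leI)
      also have "1 \<le> worst_case_ratio N lam M"
        using worst_case_ratio_ge_1[OF M _ lam] N by simp
      finally show ?thesis .
    qed
    then show ?thesis
      unfolding L_def by (meson ennreal_leI min.cobounded1 order_trans)
  qed
  ultimately show ?thesis by blast
qed

end
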